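(* Let $T=(V,E)$ be an infinite, locally finite rooted tree with root $\rho$ and let $b\in[0,1)$. For each $k$ let $T_k=(V_k,E_k)$ be the subtree induced by the set $V_k$ of vertices within distance $k$ of $\rho$, and let $\Delta_k=\Delta(T_k,b)$ be the $\ell^2(V_k)$-norm of the descendant generating function of $T_k$. Then, as $k\to\infty$: (1) If $T$ has bounded degree, then $\Delta_k=o(|V_k|)$. (2) If $b^2\,\mathrm{maxgr}\,T<1$ then $\Delta_k=O(\sqrt{|V_k|})$, and if $b^2\,\overline{\mathrm{gr}}\,T>1$ then $\Delta_k\ne O(\sqrt{|V_k|})$. (3) In particular, if $T$ is subperiodic then $\mathrm{maxgr}\,T=\overline{\mathrm{gr}}\,T$, so that $\Delta_k=O(\sqrt{|V_k|})$ when $b^2\,\overline{\mathrm{gr}}\,T<1$ and $\Delta_k\ne O(\sqrt{|V_k|})$ when $b^2\,\overline{\mathrm{gr}}\,T>1$.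
   Context: Trees: $d(v,w)$ is the graph distance; $v\le w$ means that $v$ lies on the simple path from the root $\rho$ to $w$ (endpoints included), and then $w$ is called a descendant of $v$; $D_r(v)=\{w: v\le w,\ d(v,w)=r\}$. Growth rates: $\overline{\mathrm{gr}}\,T=\limsup_{r\to\infty}|D_r(\rho)|^{1/r}$ and $\mathrm{maxgr}\,T=\limsup_{r\to\infty}\max_{v\in V}|D_r(v)|^{1/r}$ (the maximum is read as a supremum; values in $[0,\infty]$, with $0\cdot\infty=0$). Descendant generating function of a finite rooted tree $T'=(V',E')$: $\delta(v)=\sum_{r=0}^\infty|D'_r(v)|\,b^r$ for $v\in V'$, where $D'_r(v)$ is the set of descendants of $v$ in $T'$ at distance $r$ from $v$ (with $b^0=1$, also when $b=0$), and $\Delta(T',b)=\big(\sum_{v\in V'}\delta(v)^2\big)^{1/2}$. Subperiodic: for $v\in V$ let $T_v$ be the subgraph induced by the descendants of $v$ (including $v$), considered as a tree rooted at $v$. $T$ is subperiodic if there exists $R\ge0$ such that for every $v\in V$ there exists $w\in V$ with $d(\rho,w)\le R$ such that $T_v$ is isomorphic, as a rooted tree, to a subtree of $T_w$ containing the root $w$ (the isomorphism sending $v$ to $w$). *)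

theory Defs
  imports
    "HOL-Analysis.L2_Norm"
    "HOL-Library.Extended_Nonnegative_Real"
    "HOL-Library.Landau_Symbols"
begin

section \<open>Undirected simple graphs and rooted trees\<close>

text \<open>
  A graph is given by a vertex set \<open>V\<close> and a set \<open>E\<close> of two-element subsets of \<open>V\<close>.
  Walks are nonempty vertex lists, so the length of a walk \<open>p\<close> is \<open>length p - 1\<close>.
\<close>

definition simple_graph :: "'a set \<Rightarrow> 'a set set \<Rightarrow> bool" where
  "simple_graph V E \<longleftrightarrow> (\<forall>e\<in>E. e \<subseteq> V \<and> card e = 2)"

definition graph_walk :: "'a set \<Rightarrow> 'a set set \<Rightarrow> 'a \<Rightarrow> 'a list \<Rightarrow> 'a \<Rightarrow> bool" where
  "graph_walk V E v p w \<longleftrightarrow>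
     p \<noteq> [] \<and> hd p = v \<and> last p = w \<and> set p \<subseteq> V \<and> successively (\<lambda>x y. {x, y} \<in> E) p"

definition graph_path :: "'a set \<Rightarrow> 'a set set \<Rightarrow> 'a \<Rightarrow> 'a list \<Rightarrow> 'a \<Rightarrow> bool" where
  "graph_path V E v p w \<longleftrightarrow> graph_walk V E v p w \<and> distinct p"

definition graph_connected :: "'a set \<Rightarrow> 'a set set \<Rightarrow> bool" where
  "graph_connected V E \<longleftrightarrow> V \<noteq> {} \<and> (\<forall>v\<in>V. \<forall>w\<in>V. \<exists>p. graph_walk V E v p w)"

text \<open>A cycle is listed without repeating its starting vertex.\<close>

definition graph_cycle :: "'a set \<Rightarrow> 'a set set \<Rightarrow> 'a list \<Rightarrow> bool" where
  "graph_cycle V E p \<longleftrightarrow>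
     length p \<ge> 3 \<and> graph_path V E (hd p) p (last p) \<and> {last p, hd p} \<in> E"

definition graph_tree :: "'a set \<Rightarrow> 'a set set \<Rightarrow> bool" where
  "graph_tree V E \<longleftrightarrow> simple_graph V E \<and> graph_connected V E \<and> (\<nexists>p. graph_cycle V E p)"

definition rooted_tree :: "'a set \<Rightarrow> 'a set set \<Rightarrow> 'a \<Rightarrow> bool" where
  "rooted_tree V E \<rho> \<longleftrightarrow> graph_tree V E \<and> \<rho> \<in> V"

text \<open>Only meaningful when \<open>v\<close> and \<open>w\<close> are joined by some walk.\<close>

definition graph_dist :: "'a set \<Rightarrow> 'a set set \<Rightarrow> 'a \<Rightarrow> 'a \<Rightarrow> nat" where
  "graph_dist V E v w = (LEAST n. \<exists>p. graph_walk V E v p w \<and> length p = Suc n)"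

definition neighbours :: "'a set set \<Rightarrow> 'a \<Rightarrow> 'a set" where
  "neighbours E v = {w. {v, w} \<in> E}"

definition locally_finite_graph :: "'a set \<Rightarrow> 'a set set \<Rightarrow> bool" where
  "locally_finite_graph V E \<longleftrightarrow> (\<forall>v\<in>V. finite (neighbours E v))"

definition bounded_degree :: "'a set \<Rightarrow> 'a set set \<Rightarrow> bool" where
  "bounded_degree V E \<longleftrightarrow>
     (\<exists>M::nat. \<forall>v\<in>V. finite (neighbours E v) \<and> card (neighbours E v) \<le> M)"

definition induced_edges :: "'a set set \<Rightarrow> 'a set \<Rightarrow> 'a set set" where
  "induced_edges E W = {e \<in> E. e \<subseteq> W}"


section \<open>Descendants and growth rates\<close>

text \<open>In a tree the simple path \<open>p\<close> below is unique.\<close>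

definition descendant :: "'a set \<Rightarrow> 'a set set \<Rightarrow> 'a \<Rightarrow> 'a \<Rightarrow> 'a \<Rightarrow> bool" where
  "descendant V E \<rho> v w \<longleftrightarrow> (\<exists>p. graph_path V E \<rho> p w \<and> v \<in> set p)"

definition desc_at :: "'a set \<Rightarrow> 'a set set \<Rightarrow> 'a \<Rightarrow> nat \<Rightarrow> 'a \<Rightarrow> 'a set" where
  "desc_at V E \<rho> r v = {w \<in> V. descendant V E \<rho> v w \<and> graph_dist V E v w = r}"

text \<open>
  The cardinalities below are meaningful in locally finite trees, where \<open>desc_at\<close> is always
  finite. Values are in \<^typ>\<open>ennreal\<close>, where \<open>0 * \<infinity> = 0\<close>.
\<close>

definition upper_gr :: "'a set \<Rightarrow> 'a set set \<Rightarrow> 'a \<Rightarrow> ennreal" where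
  "upper_gr V E \<rho> =
     limsup (\<lambda>r. ennreal (real (card (desc_at V E \<rho> r \<rho>)) powr (1 / real r)))"

definition maxgr :: "'a set \<Rightarrow> 'a set set \<Rightarrow> 'a \<Rightarrow> ennreal" where
  "maxgr V E \<rho> =
     limsup (\<lambda>r. SUP v\<in>V. ennreal (real (card (desc_at V E \<rho> r v)) powr (1 / real r)))"


section \<open>The descendant generating function\<close>

definition desc_gf :: "'a set \<Rightarrow> 'a set set \<Rightarrow> 'a \<Rightarrow> real \<Rightarrow> 'a \<Rightarrow> real" where
  "desc_gf V E \<rho> b v = (\<Sum>r. real (card (desc_at V E \<rho> r v)) * b ^ r)"

definition desc_gf_norm :: "'a set \<Rightarrow> 'a set set \<Rightarrow> 'a \<Rightarrow> real \<Rightarrow> real" where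
  "desc_gf_norm V E \<rho> b = L2_set (desc_gf V E \<rho> b) V"

definition trunc_verts :: "'a set \<Rightarrow> 'a set set \<Rightarrow> 'a \<Rightarrow> nat \<Rightarrow> 'a set" where
  "trunc_verts V E \<rho> k = {v \<in> V. graph_dist V E \<rho> v \<le> k}"

definition trunc_edges :: "'a set \<Rightarrow> 'a set set \<Rightarrow> 'a \<Rightarrow> nat \<Rightarrow> 'a set set" where
  "trunc_edges V E \<rho> k = induced_edges E (trunc_verts V E \<rho> k)"

definition trunc_norm :: "'a set \<Rightarrow> 'a set set \<Rightarrow> 'a \<Rightarrow> real \<Rightarrow> nat \<Rightarrow> real" where
  "trunc_norm V E \<rho> b k = desc_gf_norm (trunc_verts V E \<rho> k) (trunc_edges V E \<rho> k) \<rho> b"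


section \<open>Subperiodic trees\<close>

definition desc_verts :: "'a set \<Rightarrow> 'a set set \<Rightarrow> 'a \<Rightarrow> 'a \<Rightarrow> 'a set" where
  "desc_verts V E \<rho> v = {w \<in> V. descendant V E \<rho> v w}"

definition desc_edges :: "'a set \<Rightarrow> 'a set set \<Rightarrow> 'a \<Rightarrow> 'a \<Rightarrow> 'a set set" where
  "desc_edges V E \<rho> v = induced_edges E (desc_verts V E \<rho> v)"

definition rooted_isomorphic ::
  "'a set \<Rightarrow> 'a set set \<Rightarrow> 'a \<Rightarrow> 'b set \<Rightarrow> 'b set set \<Rightarrow> 'b \<Rightarrow> bool" where
  "rooted_isomorphic V1 E1 r1 V2 E2 r2 \<longleftrightarrow>
     (\<exists>f. bij_betw f V1 V2 \<and> f r1 = r2 \<and>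
          (\<forall>x\<in>V1. \<forall>y\<in>V1. {x, y} \<in> E1 \<longleftrightarrow> {f x, f y} \<in> E2))"

definition subperiodic :: "'a set \<Rightarrow> 'a set set \<Rightarrow> 'a \<Rightarrow> bool" where
  "subperiodic V E \<rho> \<longleftrightarrow>
     (\<exists>R::nat. \<forall>v\<in>V. \<exists>w\<in>V. graph_dist V E \<rho> w \<le> R \<and>
        (\<exists>V' E'. V' \<subseteq> desc_verts V E \<rho> w \<and> E' \<subseteq> desc_edges V E \<rho> w \<and>
           rooted_tree V' E' w \<and>
           rooted_isomorphic (desc_verts V E \<rho> v) (desc_edges V E \<rho> v) v V' E' w))"

end

theory Submission
  imports Defs "HOL-Analysis.Uniform_Limit"
begin

text \<open>
  Let \<open>V\<^sub>k\<close> be the vertices of depth at most \<open>k\<close>, and expand the descendant generating function of the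
  truncated tree \<open>T\<^sub>k\<close> as \<open>\<delta> = \<Sum>\<^sub>r b\<^sup>r |D\<^sub>r|\<close>. The triangle inequality in \<open>\<ell>\<^sup>2(V\<^sub>k)\<close> reduces upper bounds
  on \<open>\<Delta>\<^sub>k\<close> to the norms of the functions \<open>v \<mapsto> |D\<^sub>r(v)|\<close> (\<open>trunc_norm_le\<close>). A vertex has at most one
  ancestor at distance \<open>r\<close>, so these functions have \<open>\<ell>\<^sup>1\<close> norm at most \<open>|V\<^sub>k|\<close>. Hence their \<open>\<ell>\<^sup>2\<close>
  norm is at most \<open>|V\<^sub>k|\<close>, and also at most \<open>\<surd>(M\<^sub>r |V\<^sub>k|)\<close> with \<open>M\<^sub>r = sup\<^sub>v |D\<^sub>r(v)|\<close>.

  If the degrees are bounded, all \<open>M\<^sub>r\<close> are finite. Each term of \<open>\<Delta>\<^sub>k / |V\<^sub>k|\<close> then tends to 0 by the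
  second estimate and is dominated by \<open>b\<^sup>r\<close> by the first, so the sum tends to 0
  (\<open>trunc_norm_smallo\<close>). If \<open>b\<^sup>2 maxgr T < 1\<close>, the root test makes \<open>\<Sum>\<^sub>r b\<^sup>r \<surd>M\<^sub>r\<close> converge, and the
  second estimate alone gives \<open>\<Delta>\<^sub>k = O(\<surd>|V\<^sub>k|)\<close> (\<open>trunc_norm_bigo\<close>).

  Conversely, let \<open>b > 0\<close>. Then \<open>\<Delta>\<^sub>k \<ge> b\<^sup>k |D\<^sub>k(\<rho>)|\<close> because of the root alone. If \<open>\<Delta>\<^sub>k = O(\<surd>|V\<^sub>k|)\<close>, the last level is
  therefore at most \<open>C b\<^sup>-\<^sup>k \<surd>|V\<^sub>k|\<close>. This is a recursive inequality for \<open>\<surd>|V\<^sub>k|\<close>, whose increments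
  are bounded by \<open>C b\<^sup>-\<^sup>k\<close>; it gives \<open>|V\<^sub>k| = O(b\<^sup>-\<^sup>2\<^sup>k)\<close>, so the upper growth rate is at most \<open>b\<^sup>-\<^sup>2\<close>
  (\<open>upper_gr_le_of_bigo\<close>).

  In a subperiodic tree, \<open>D\<^sub>r(v)\<close> embeds into \<open>D\<^sub>r(w)\<close> for some \<open>w\<close> of depth at most \<open>R\<close>, hence into
  a level between \<open>r\<close> and \<open>r + R\<close>, and the two growth rates agree (\<open>maxgr_eq_upper_gr\<close>).

  All of this rests on the uniqueness of paths in a graph without cycles (\<open>path_unique\<close>), through the
  description of descendants at distance \<open>r\<close> by paths from the root (\<open>mem_desc_at_iff\<close>).
\<close>

section \<open>Paths in graphs\<close>

lemma graph_path_prefix: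
  "graph_path V E u (p @ x # q) w \<Longrightarrow> graph_path V E u (p @ [x]) x"
  by (auto simp: graph_path_def graph_walk_def successively_append_iff successively_Cons hd_append)

lemma graph_path_suffix:
  "graph_path V E u (p @ x # q) w \<Longrightarrow> graph_path V E x (x # q) w"
  by (auto simp: graph_path_def graph_walk_def successively_append_iff)

lemma graph_path_subgraph:
  assumes "graph_path V' E' u p w" "V' \<subseteq> V" "E' \<subseteq> E"
  shows "graph_path V E u p w"
proof -
  have "successively (\<lambda>x y. {x, y} \<in> E) p"
    using assms by (auto simp: graph_path_def graph_walk_def intro: successively_mono)
  then show ?thesis
    using assms by (auto simp: graph_path_def graph_walk_def)
qed

lemma graph_path_of_walk:
  assumes "graph_walk V E u p w"
  obtains q where "graph_path V E u q w" "length q \<le> length p"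
  using assms
proof (induction "length p" arbitrary: p thesis rule: less_induct)
  case less
  show ?case
  proof (cases "distinct p")
    case True
    then show ?thesis using less.prems by (auto simp: graph_path_def)
  next
    case False
    then obtain xs ys zs y where p: "p = xs @ [y] @ ys @ [y] @ zs"
      using not_distinct_decomp by blast
    have "graph_walk V E u (xs @ y # zs) w"
      using less.prems(2) unfolding p
      by (auto simp: graph_walk_def successively_append_iff successively_Cons hd_append)
    moreover have "length (xs @ y # zs) < length p" by (simp add: p)
    ultimately obtain q where "graph_path V E u q w" "length q \<le> length (xs @ y # zs)"
      using less.hyps by blast
    then show ?thesis
      using less.prems(1) \<open>length (xs @ y # zs) < length p\<close> by simp
  qed
qed

section \<open>Descendants in a forest\<close>

text \<open>
  Subgraphs inherit the absence of cycles, so what is proved here applies both to the tree and to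
  its truncations.
\<close>

locale acyclic_graph =
  fixes V :: "'a set" and E :: "'a set set"
  assumes no_cycle: "\<not> graph_cycle V E p"
begin

text \<open>
  Follow two paths to the first edges at which they part, and along the first path to the first
  vertex where it meets the second again; the two segments in between close up to a cycle.
\<close>

lemma path_unique:
  assumes "graph_path V E v p w" "graph_path V E v q w"
  shows "p = q"
  using assms
proof (induction p arbitrary: v q)
  case Nil
  then show ?case by (simp add: graph_path_def graph_walk_def)
next
  case (Cons a p')
  have a: "a = v" using Cons.prems by (simp add: graph_path_def graph_walk_def)
  obtain q' where q: "q = v # q'"
    using Cons.prems(2) by (cases q) (auto simp: graph_path_def graph_walk_def)
  have P: "last (v # p') = w" "distinct (v # p')" "set (v # p') \<subseteq> V"
    "successively (\<lambda>x y. {x, y} \<in> E) (v # p')"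
    using Cons.prems(1) a by (auto simp: graph_path_def graph_walk_def)
  have Q: "last (v # q') = w" "distinct (v # q')" "set (v # q') \<subseteq> V"
    "successively (\<lambda>x y. {x, y} \<in> E) (v # q')"
    using Cons.prems(2) q by (auto simp: graph_path_def graph_walk_def)
  have "p' = q'"
  proof (cases "p' = [] \<or> q' = []")
    case True
    then show ?thesis using P(1,2) Q(1,2) by (auto split: if_splits)
  next
    case False
    then have ne: "p' \<noteq> []" "q' \<noteq> []" by auto
    have P': "successively (\<lambda>x y. {x, y} \<in> E) p'" "{v, hd p'} \<in> E"
      and Q': "successively (\<lambda>x y. {x, y} \<in> E) q'" "{v, hd q'} \<in> E"
      using P(4) Q(4) ne by (auto simp: successively_Cons)
    have lp: "last p' = w" "last q' = w" using P(1) Q(1) ne by auto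
    show ?thesis
    proof (cases "hd p' = hd q'")
      case True
      have "graph_path V E (hd p') p' w" "graph_path V E (hd p') q' w"
        using P Q P' Q' ne lp True by (auto simp: graph_path_def graph_walk_def)
      then show ?thesis by (rule Cons.IH)
    next
      case False
      have "\<exists>x\<in>set p'. x \<in> set q'" using lp ne last_in_set by metis
      then obtain p1 x p2 where p': "p' = p1 @ x # p2" "x \<in> set q'" "\<forall>y\<in>set p1. y \<notin> set q'"
        using split_list_first_prop[of p' "\<lambda>x. x \<in> set q'"] by blast
      obtain q1 q2 where q': "q' = q1 @ x # q2" using p'(2) by (meson split_list)
      \<comment> \<open>from \<open>v\<close> along \<open>p\<close> to the meeting point \<open>x\<close>, then back along \<open>q\<close>\<close>
      let ?c = "v # p1 @ x # rev q1"
      have "p1 \<noteq> [] \<or> q1 \<noteq> []" using False p' q' by auto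
      then have "length ?c \<ge> 3" by (cases p1; cases q1) auto
      moreover have "distinct ?c" using P(2) Q(2) p' q' by auto
      moreover have "set ?c \<subseteq> V" using P(3) Q(3) p' q' by auto
      moreover have "successively (\<lambda>x y. {x, y} \<in> E) ?c"
        using P(4) Q'(1) p'(1) q'
        by (auto simp: successively_append_iff successively_Cons insert_commute hd_rev hd_append
            split: if_splits)
      moreover have "{last ?c, v} \<in> E"
        using Q'(2) q' by (cases q1) (auto simp: insert_commute)
      ultimately have "graph_cycle V E ?c"
        by (simp add: graph_cycle_def graph_path_def graph_walk_def)
      then show ?thesis using no_cycle by blast
    qed
  qed
  then show ?case using a q by simp
qed

lemma graph_dist_path:
  assumes "graph_path V E v p w"
  shows "graph_dist V E v w = length p - 1"
  unfolding graph_dist_def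
proof (rule Least_equality)
  show "\<exists>p'. graph_walk V E v p' w \<and> length p' = Suc (length p - 1)"
    using assms by (intro exI[of _ p]) (auto simp: graph_path_def graph_walk_def)
next
  fix n
  assume "\<exists>p'. graph_walk V E v p' w \<and> length p' = Suc n"
  then obtain p' where "graph_walk V E v p' w" "length p' = Suc n" by blast
  then obtain q where "graph_path V E v q w" "length q \<le> Suc n"
    using graph_path_of_walk by metis
  then show "length p - 1 \<le> n" using path_unique[OF assms] by fastforce
qed

text \<open>
  As paths are unique, the distance to a descendant can be read off the path from the root: this
  turns \<open>desc_at\<close>, defined through a minimum over walks, into a statement about lists.
\<close>

lemma mem_desc_at_iff:
  "w \<in> desc_at V E \<rho> r v \<longleftrightarrow> (\<exists>p q. graph_path V E \<rho> (p @ v # q) w \<and> length q = r)"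
proof
  assume "w \<in> desc_at V E \<rho> r v"
  then obtain p where p: "graph_path V E \<rho> p w" "v \<in> set p" "graph_dist V E v w = r"
    by (auto simp: desc_at_def descendant_def)
  obtain p1 q where pq: "p = p1 @ v # q" using p(2) by (meson split_list)
  have "length q = r"
    using graph_dist_path[OF graph_path_suffix[OF p(1)[unfolded pq]]] p(3) by simp
  then show "\<exists>p q. graph_path V E \<rho> (p @ v # q) w \<and> length q = r" using p(1) pq by blast
next
  assume "\<exists>p q. graph_path V E \<rho> (p @ v # q) w \<and> length q = r"
  then obtain p q where pq: "graph_path V E \<rho> (p @ v # q) w" "length q = r" by blast
  have "w \<in> V"
    using pq(1) last_in_set[of "p @ v # q"] by (auto simp: graph_path_def graph_walk_def)
  moreover have "graph_dist V E v w = r"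
    using graph_dist_path[OF graph_path_suffix[OF pq(1)]] pq(2) by simp
  moreover have "descendant V E \<rho> v w"
    using pq(1) by (auto simp: descendant_def)
  ultimately show "w \<in> desc_at V E \<rho> r v" by (simp add: desc_at_def)
qed

lemma desc_atI:
  "graph_path V E \<rho> (p @ v # q) w \<Longrightarrow> w \<in> desc_at V E \<rho> (length q) v"
  unfolding mem_desc_at_iff by blast

lemma desc_atE:
  assumes "w \<in> desc_at V E \<rho> r v"
  obtains p q where "graph_path V E \<rho> (p @ v # q) w" "length q = r"
  using assms unfolding mem_desc_at_iff by blast

text \<open>
  A vertex has at most one ancestor at a given distance. This is what makes the sum of the
  \<open>desc_at\<close> cardinalities over all vertices no larger than the number of vertices.
\<close>

lemma desc_at_disjoint:
  assumes "v \<noteq> v'"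
  shows "desc_at V E \<rho> r v \<inter> desc_at V E \<rho> r v' = {}"
proof (rule ccontr)
  assume "\<not> ?thesis"
  then obtain w where w: "w \<in> desc_at V E \<rho> r v" "w \<in> desc_at V E \<rho> r v'" by blast
  obtain p q where pq: "graph_path V E \<rho> (p @ v # q) w" "length q = r"
    using w(1) by (rule desc_atE)
  obtain p' q' where pq': "graph_path V E \<rho> (p' @ v' # q') w" "length q' = r"
    using w(2) by (rule desc_atE)
  have eq: "p @ v # q = p' @ v' # q'" "length (v # q) = length (v' # q')"
    using path_unique[OF pq(1) pq'(1)] pq(2) pq'(2) by auto
  then have "v # q = v' # q'" using append_eq_append_conv by blast
  then show False using assms by simp
qed

lemma desc_at_trans:
  assumes "v \<in> desc_at V E \<rho> s u"
  shows "desc_at V E \<rho> r v \<subseteq> desc_at V E \<rho> (s + r) u"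
proof
  fix w
  assume "w \<in> desc_at V E \<rho> r v"
  then obtain p q where pq: "graph_path V E \<rho> (p @ v # q) w" "length q = r"
    by (rule desc_atE)
  obtain p' q' where pq': "graph_path V E \<rho> (p' @ u # q') v" "length q' = s"
    using assms by (rule desc_atE)
  have "p @ [v] = p' @ u # q'"
    using path_unique[OF graph_path_prefix[OF pq(1)] pq'(1)] .
  then have "p @ v # q = p' @ u # (q' @ q)" by (metis append.assoc append_Cons append_Nil)
  then have "graph_path V E \<rho> (p' @ u # (q' @ q)) w" using pq(1) by (simp only:)
  then show "w \<in> desc_at V E \<rho> (s + r) u"
    using desc_atI[of \<rho> p' u "q' @ q" w] pq(2) pq'(2) by simp
qed

lemma desc_at_0_subset: "desc_at V E \<rho> 0 v \<subseteq> {v}"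
  by (auto simp: mem_desc_at_iff graph_path_def graph_walk_def)

lemma desc_at_Suc_subset:
  "desc_at V E \<rho> (Suc r) v \<subseteq> (\<Union>u\<in>desc_at V E \<rho> r v. neighbours E u)"
proof
  fix w
  assume "w \<in> desc_at V E \<rho> (Suc r) v"
  then obtain p q where pq: "graph_path V E \<rho> (p @ v # q) w" "length q = Suc r"
    by (rule desc_atE)
  then obtain q' where q: "q = q' @ [w]"
    by (cases q rule: rev_cases) (auto simp: graph_path_def graph_walk_def)
  define u where "u = last (v # q')"
  have uE: "{u, w} \<in> E"
    using pq(1) unfolding q u_def
    by (auto simp: graph_path_def graph_walk_def successively_append_iff successively_Cons
        split: if_splits)
  have "graph_path V E \<rho> (p @ v # q') u"
    using pq(1) unfolding q u_def
    by (auto simp: graph_path_def graph_walk_def successively_append_iff successively_Cons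
        hd_append split: if_splits)
  then have "u \<in> desc_at V E \<rho> r v" using desc_atI[of \<rho> p v q'] pq(2) q by simp
  then show "w \<in> (\<Union>u\<in>desc_at V E \<rho> r v. neighbours E u)"
    using uE by (auto simp: neighbours_def)
qed

lemma acyclic_subgraph:
  assumes "V' \<subseteq> V" "E' \<subseteq> E"
  shows "acyclic_graph V' E'"
proof
  fix p show "\<not> graph_cycle V' E' p"
    using no_cycle[of p] graph_path_subgraph[OF _ assms] assms by (auto simp: graph_cycle_def)
qed

lemma desc_at_subgraph:
  assumes "V' \<subseteq> V" "E' \<subseteq> E"
  shows "desc_at V' E' \<rho> r v \<subseteq> desc_at V E \<rho> r v"
proof -
  interpret sub: acyclic_graph V' E' using assms by (rule acyclic_subgraph)
  show ?thesis
  proof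
    fix w
    assume "w \<in> desc_at V' E' \<rho> r v"
    then obtain p q where "graph_path V' E' \<rho> (p @ v # q) w" "length q = r"
      by (rule sub.desc_atE)
    then show "w \<in> desc_at V E \<rho> r v"
      using desc_atI graph_path_subgraph[OF _ assms] by blast
  qed
qed


section \<open>Norms of the level counts of a finite forest\<close>

lemma sum_card_desc_at_le:
  assumes "finite V"
  shows "(\<Sum>v\<in>V. card (desc_at V E \<rho> r v)) \<le> card V"
proof -
  have sub: "desc_at V E \<rho> r v \<subseteq> V" for v by (auto simp: desc_at_def)
  have "(\<Sum>v\<in>V. card (desc_at V E \<rho> r v)) = card (\<Union>v\<in>V. desc_at V E \<rho> r v)"
    using assms sub desc_at_disjoint
    by (intro card_UN_disjoint[symmetric]) (auto intro: finite_subset)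
  also have "\<dots> \<le> card V" using assms sub by (intro card_mono) auto
  finally show ?thesis .
qed

text \<open>
  Both estimates of the \<open>\<ell>\<^sup>2\<close> norm of \<open>v \<mapsto> |D\<^sub>r(v)|\<close> start from the \<open>\<ell>\<^sup>1\<close> norm being at most
  \<open>|V|\<close>: the first one compares \<open>\<ell>\<^sup>2\<close> with \<open>\<ell>\<^sup>1\<close>, the
  second one gains a square root by interpolating with the \<open>\<ell>\<^sup>\<infinity>\<close> norm.
\<close>

lemma L2_set_desc_at_le_card:
  assumes "finite V"
  shows "L2_set (\<lambda>v. real (card (desc_at V E \<rho> r v))) V \<le> real (card V)"
proof -
  have "L2_set (\<lambda>v. real (card (desc_at V E \<rho> r v))) V
      \<le> (\<Sum>v\<in>V. real (card (desc_at V E \<rho> r v)))"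
    by (intro L2_set_le_sum) auto
  also have "\<dots> \<le> real (card V)"
    using sum_card_desc_at_le[OF assms, of \<rho> r] by (simp flip: of_nat_sum)
  finally show ?thesis .
qed

lemma L2_set_desc_at_le_sqrt:
  assumes "finite V" and bd: "\<And>v. v \<in> V \<Longrightarrow> real (card (desc_at V E \<rho> r v)) \<le> B" and "0 \<le> B"
  shows "L2_set (\<lambda>v. real (card (desc_at V E \<rho> r v))) V \<le> sqrt B * sqrt (real (card V))"
proof -
  have "(\<Sum>v\<in>V. (real (card (desc_at V E \<rho> r v)))\<^sup>2)
      \<le> (\<Sum>v\<in>V. B * real (card (desc_at V E \<rho> r v)))"
    unfolding power2_eq_square using bd by (intro sum_mono mult_right_mono) auto
  also have "\<dots> = B * real (\<Sum>v\<in>V. card (desc_at V E \<rho> r v))"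
    by (simp add: sum_distrib_left)
  also have "\<dots> \<le> B * real (card V)"
    using sum_card_desc_at_le[OF assms(1), of \<rho> r] \<open>0 \<le> B\<close>
    by (intro mult_left_mono of_nat_mono)
  finally show ?thesis by (simp add: L2_set_def flip: real_sqrt_mult)
qed

end

lemma L2_set_sum_le:
  assumes "finite I"
  shows "L2_set (\<lambda>x. \<Sum>i\<in>I. f i x) A \<le> (\<Sum>i\<in>I. L2_set (f i) A)"
  using assms
proof (induction I rule: finite_induct)
  case empty
  then show ?case by (simp add: L2_set_0')
next
  case (insert i I)
  have "L2_set (\<lambda>x. f i x + (\<Sum>i\<in>I. f i x)) A \<le> L2_set (f i) A + L2_set (\<lambda>x. \<Sum>i\<in>I. f i x) A"
    by (rule L2_set_triangle_ineq)
  then show ?case using insert by simp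
qed

section \<open>Levels of a locally finite rooted tree\<close>

locale locally_finite_tree = acyclic_graph V E for V :: "'a set" and E +
  fixes \<rho> :: 'a
  assumes connected: "graph_connected V E" and root_in: "\<rho> \<in> V"
    and locally_finite: "locally_finite_graph V E"
begin

abbreviation "D \<equiv> desc_at V E \<rho>"
abbreviation "depth \<equiv> graph_dist V E \<rho>"
abbreviation "verts \<equiv> trunc_verts V E \<rho>"
abbreviation "truncD k \<equiv> desc_at (verts k) (trunc_edges V E \<rho> k) \<rho>"

lemma root_path:
  assumes "v \<in> V"
  obtains p where "graph_path V E \<rho> p v" "length p = Suc (depth v)"
proof -
  obtain p where "graph_walk V E \<rho> p v"
    using connected root_in assms by (auto simp: graph_connected_def)
  then obtain q where q: "graph_path V E \<rho> q v" using graph_path_of_walk by metis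
  moreover have "q \<noteq> []" using q by (auto simp: graph_path_def graph_walk_def)
  ultimately show ?thesis using that[of q] graph_dist_path[OF q] by (cases q) auto
qed

lemma level_eq: "D r \<rho> = {w \<in> V. depth w = r}"
proof -
  have "descendant V E \<rho> \<rho> w" if "w \<in> V" for w
  proof -
    obtain p where "graph_path V E \<rho> p w" using root_path[OF \<open>w \<in> V\<close>] by blast
    then show ?thesis
      by (auto simp: descendant_def graph_path_def graph_walk_def intro!: exI[of _ p])
  qed
  then show ?thesis by (auto simp: desc_at_def)
qed

lemma desc_at_depth:
  assumes "w \<in> D r v"
  shows "v \<in> V" "w \<in> V" "depth w = depth v + r"
proof -
  obtain p q where pq: "graph_path V E \<rho> (p @ v # q) w" "length q = r"
    using assms by (rule desc_atE)
  show "v \<in> V" using pq(1) by (auto simp: graph_path_def graph_walk_def)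
  show "w \<in> V" using assms by (auto simp: desc_at_def)
  show "depth w = depth v + r"
    using graph_dist_path[OF pq(1)] graph_dist_path[OF graph_path_prefix[OF pq(1)]] pq(2) by simp
qed

text \<open>
  The ancestor at distance \<open>s\<close> is the vertex \<open>s\<close> places before the end of the path from the root.
\<close>

lemma ex_ancestor:
  assumes "v \<in> V" "s \<le> depth v"
  obtains u where "u \<in> V" "v \<in> D s u"
proof -
  obtain p where p: "graph_path V E \<rho> p v" "length p = Suc (depth v)"
    using root_path[OF assms(1)] by blast
  define i where "i = depth v - s"
  have i: "i < length p" using p(2) by (simp add: i_def)
  have split: "p = take i p @ p ! i # drop (Suc i) p" using i by (rule id_take_nth_drop)
  have "graph_path V E \<rho> (take i p @ p ! i # drop (Suc i) p) v" using p(1) split by simp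
  then have "v \<in> D (length (drop (Suc i) p)) (p ! i)" by (rule desc_atI)
  moreover have "length (drop (Suc i) p) = s" using p(2) assms(2) by (simp add: i_def)
  ultimately have "v \<in> D s (p ! i)" by simp
  then show ?thesis using that desc_at_depth(1) by blast
qed

lemma finite_desc_at: "finite (D r v)"
proof (induction r)
  case 0
  show ?case by (rule finite_subset[OF desc_at_0_subset]) simp
next
  case (Suc r)
  have "finite (\<Union>u\<in>D r v. neighbours E u)"
    using Suc locally_finite desc_at_depth(2) by (auto simp: locally_finite_graph_def)
  then show ?case by (rule finite_subset[OF desc_at_Suc_subset])
qed

lemma card_desc_at_le_power:
  assumes M: "\<And>v. v \<in> V \<Longrightarrow> card (neighbours E v) \<le> M"
  shows "card (D r v) \<le> M ^ r"
proof (induction r)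
  case 0
  then show ?case using card_mono[OF _ desc_at_0_subset[of \<rho> v]] by simp
next
  case (Suc r)
  have fin: "finite (\<Union>u\<in>D r v. neighbours E u)"
    using finite_desc_at locally_finite desc_at_depth(2) by (auto simp: locally_finite_graph_def)
  have "card (D (Suc r) v) \<le> card (\<Union>u\<in>D r v. neighbours E u)"
    using fin desc_at_Suc_subset by (rule card_mono)
  also have "\<dots> \<le> (\<Sum>u\<in>D r v. card (neighbours E u))"
    using finite_desc_at by (rule card_UN_le)
  also have "\<dots> \<le> card (D r v) * M"
    using sum_bounded_above[of "D r v" "\<lambda>u. card (neighbours E u)" M] M desc_at_depth(2) by simp
  also have "\<dots> \<le> M ^ r * M" using Suc by simp
  finally show ?case by (simp add: mult.commute)
qed

lemma verts_eq: "verts k = (\<Union>r\<le>k. D r \<rho>)"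
  by (auto simp: trunc_verts_def level_eq)

lemma finite_verts: "finite (verts k)"
  by (simp add: verts_eq finite_desc_at)

lemma verts_subset: "verts k \<subseteq> V"
  by (auto simp: trunc_verts_def)

lemma root_in_verts: "\<rho> \<in> verts k"
proof -
  have "graph_path V E \<rho> [\<rho>] \<rho>" using root_in by (simp add: graph_path_def graph_walk_def)
  then have "depth \<rho> = 0" using graph_dist_path by fastforce
  then show ?thesis using root_in by (simp add: trunc_verts_def)
qed

lemma card_verts_Suc: "card (verts (Suc k)) = card (verts k) + card (D (Suc k) \<rho>)"
proof -
  have "verts (Suc k) = verts k \<union> D (Suc k) \<rho>" by (auto simp: trunc_verts_def level_eq)
  moreover have "verts k \<inter> D (Suc k) \<rho> = {}" by (auto simp: trunc_verts_def level_eq)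
  ultimately show ?thesis
    using card_Un_disjoint[OF finite_verts finite_desc_at] by metis
qed

lemma card_level_le: "card (D k \<rho>) \<le> card (verts k)"
  by (intro card_mono finite_verts) (auto simp: trunc_verts_def level_eq)

lemma filterlim_card_verts:
  assumes "infinite V"
  shows "filterlim (\<lambda>k. real (card (verts k))) at_top sequentially"
proof -
  have "filterlim (\<lambda>k. card (verts k)) at_top sequentially"
    unfolding filterlim_at_top
  proof
    fix N :: nat
    obtain F where F: "finite F" "card F = N" "F \<subseteq> V"
      using infinite_arbitrarily_large[OF assms] by blast
    show "\<forall>\<^sub>F k in sequentially. N \<le> card (verts k)"
      using eventually_ge_at_top[of "Max (depth ` F)"]
    proof eventually_elim
      case (elim k)
      have "depth x \<le> k" if "x \<in> F" for x
      proof -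
        have "depth x \<le> Max (depth ` F)" using that F(1) by (intro Max_ge) auto
        also have "\<dots> \<le> k" by (rule elim)
        finally show ?thesis .
      qed
      then have "F \<subseteq> verts k" using F(3) by (auto simp: trunc_verts_def)
      then show ?case using F(2) card_mono[OF finite_verts] by blast
    qed
  qed
  then show ?thesis by (rule filterlim_compose[OF filterlim_real_sequentially])
qed

text \<open>
  Bounds on \<open>sup\<^sub>v |D\<^sub>s(v)|\<close> for large \<open>s\<close> are what \<open>maxgr\<close> provides; they pass to every \<open>r \<le> s\<close>. A
  vertex deep enough has an ancestor at distance \<open>s - r\<close>, whose \<open>s\<close>-th generation contains the
  \<open>r\<close>-th generation of the vertex, and only finitely many vertices are not deep enough.
\<close>

lemma card_desc_at_bounded_downward:
  assumes B: "\<And>v. v \<in> V \<Longrightarrow> card (D s v) \<le> B" and "r \<le> s"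
  shows "\<exists>B'. \<forall>v\<in>V. card (D r v) \<le> B'"
proof -
  have fin: "finite ((\<lambda>v. card (D r v)) ` verts s)" using finite_verts by simp
  have "card (D r v) \<le> max B (Max ((\<lambda>v. card (D r v)) ` verts s))" if v: "v \<in> V" for v
  proof (cases "depth v \<le> s")
    case True
    then have "v \<in> verts s" using v by (simp add: trunc_verts_def)
    then show ?thesis using fin by (simp add: max.coboundedI2)
  next
    case False
    then have "s - r \<le> depth v" by simp
    then obtain u where u: "u \<in> V" "v \<in> D (s - r) u" by (rule ex_ancestor[OF v])
    have "D r v \<subseteq> D s u" using desc_at_trans[OF u(2), of r] assms(2) by simp
    then have "card (D r v) \<le> card (D s u)" using finite_desc_at by (rule card_mono[rotated])
    then show ?thesis using B[OF u(1)] by simp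
  qed
  then show ?thesis by blast
qed

section \<open>Truncated trees\<close>

lemma trunc_edges_subset: "trunc_edges V E \<rho> k \<subseteq> E"
  by (auto simp: trunc_edges_def induced_edges_def)

lemma truncD_subset: "truncD k r v \<subseteq> D r v"
  by (rule desc_at_subgraph[OF verts_subset trunc_edges_subset])

lemma truncD_empty: "k < r \<Longrightarrow> truncD k r v = {}"
proof (rule ccontr)
  assume "k < r" "truncD k r v \<noteq> {}"
  then obtain w where w: "w \<in> truncD k r v" by blast
  then have "w \<in> verts k" by (auto simp: desc_at_def)
  moreover have "depth w = depth v + r" using w truncD_subset desc_at_depth(3) by blast
  ultimately show False using \<open>k < r\<close> by (simp add: trunc_verts_def)
qed

text \<open>
  The path from the root to a vertex of depth at most \<open>k\<close> stays within depth \<open>k\<close>, so truncation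
  loses none of the first \<open>k\<close> levels.
\<close>

lemma truncD_root:
  assumes "r \<le> k"
  shows "truncD k r \<rho> = D r \<rho>"
proof
  interpret trunc: acyclic_graph "verts k" "trunc_edges V E \<rho> k"
    by (rule acyclic_subgraph[OF verts_subset trunc_edges_subset])
  show "truncD k r \<rho> \<subseteq> D r \<rho>" by (rule truncD_subset)
  show "D r \<rho> \<subseteq> truncD k r \<rho>"
  proof
    fix w
    assume "w \<in> D r \<rho>"
    then obtain p q where pq: "graph_path V E \<rho> (p @ \<rho> # q) w" "length q = r"
      by (rule desc_atE)
    have p: "p = []" using pq(1) by (cases p) (auto simp: graph_path_def graph_walk_def)
    have sub: "set (p @ \<rho> # q) \<subseteq> verts k"
    proof
      fix x
      assume x: "x \<in> set (p @ \<rho> # q)"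
      then obtain xs ys where xs: "p @ \<rho> # q = xs @ x # ys" by (meson split_list)
      have "depth x = length xs"
        using graph_dist_path[OF graph_path_prefix[OF pq(1)[unfolded xs]]] by simp
      moreover have "length (p @ \<rho> # q) = length (xs @ x # ys)" using xs by simp
      then have "length xs \<le> r" using p pq(2) by simp
      moreover have "x \<in> V" using x pq(1) by (auto simp: graph_path_def graph_walk_def)
      ultimately show "x \<in> verts k" using assms by (simp add: trunc_verts_def)
    qed
    have "successively (\<lambda>x y. {x, y} \<in> trunc_edges V E \<rho> k) (p @ \<rho> # q)"
    proof (rule successively_mono)
      show "successively (\<lambda>x y. {x, y} \<in> E) (p @ \<rho> # q)"
        using pq(1) by (simp add: graph_path_def graph_walk_def)
    next
      fix x y
      assume "x \<in> set (p @ \<rho> # q)" "y \<in> set (p @ \<rho> # q)" "{x, y} \<in> E"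
      then show "{x, y} \<in> trunc_edges V E \<rho> k"
        using sub by (auto simp: trunc_edges_def induced_edges_def)
    qed
    then have "graph_path (verts k) (trunc_edges V E \<rho> k) \<rho> (p @ \<rho> # q) w"
      using pq(1) sub by (simp add: graph_path_def graph_walk_def)
    then show "w \<in> truncD k r \<rho>" using trunc.desc_atI pq(2) by blast
  qed
qed

lemma trunc_desc_gf_eq:
  "desc_gf (verts k) (trunc_edges V E \<rho> k) \<rho> b v = (\<Sum>r\<le>k. b ^ r * real (card (truncD k r v)))"
  unfolding desc_gf_def
  by (subst suminf_finite[of "{..k}"]) (auto simp: truncD_empty mult.commute)

text \<open>
  This is Minkowski's inequality for the expansion of the generating function in powers of \<open>b\<close>.
\<close>

lemma trunc_norm_le:
  assumes "0 \<le> b"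
  shows "trunc_norm V E \<rho> b k
    \<le> (\<Sum>r\<le>k. b ^ r * L2_set (\<lambda>v. real (card (truncD k r v))) (verts k))"
proof -
  have "trunc_norm V E \<rho> b k
      = L2_set (\<lambda>v. \<Sum>r\<le>k. b ^ r * real (card (truncD k r v))) (verts k)"
    unfolding trunc_norm_def desc_gf_norm_def by (intro L2_set_cong refl trunc_desc_gf_eq)
  also have "\<dots> \<le> (\<Sum>r\<le>k. L2_set (\<lambda>v. b ^ r * real (card (truncD k r v))) (verts k))"
    by (rule L2_set_sum_le) simp
  also have "\<dots> = (\<Sum>r\<le>k. b ^ r * L2_set (\<lambda>v. real (card (truncD k r v))) (verts k))"
    using assms by (simp add: L2_set_right_distrib)
  finally show ?thesis .
qed

lemma truncD_L2_le_card:
  "L2_set (\<lambda>v. real (card (truncD k r v))) (verts k) \<le> real (card (verts k))"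
proof -
  interpret trunc: acyclic_graph "verts k" "trunc_edges V E \<rho> k"
    by (rule acyclic_subgraph[OF verts_subset trunc_edges_subset])
  show ?thesis by (rule trunc.L2_set_desc_at_le_card[OF finite_verts])
qed

lemma truncD_L2_le_sqrt:
  assumes "\<And>v. v \<in> V \<Longrightarrow> real (card (D r v)) \<le> B" "0 \<le> B"
  shows "L2_set (\<lambda>v. real (card (truncD k r v))) (verts k) \<le> sqrt B * sqrt (real (card (verts k)))"
proof -
  interpret trunc: acyclic_graph "verts k" "trunc_edges V E \<rho> k"
    by (rule acyclic_subgraph[OF verts_subset trunc_edges_subset])
  have "real (card (truncD k r v)) \<le> B" if "v \<in> verts k" for v
  proof -
    have "card (truncD k r v) \<le> card (D r v)"
      using finite_desc_at truncD_subset by (rule card_mono)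
    then show ?thesis using assms(1)[of v] that verts_subset[of k] by fastforce
  qed
  then show ?thesis
    using assms(2) by (rule trunc.L2_set_desc_at_le_sqrt[OF finite_verts])
qed

lemma trunc_norm_nonneg: "0 \<le> trunc_norm V E \<rho> b k"
  by (simp add: trunc_norm_def desc_gf_norm_def)

text \<open>
  The value at the root alone, and in it only the contribution of the last level, is already
  enough to detect supercritical growth.
\<close>

lemma trunc_norm_ge_level:
  assumes "0 \<le> b"
  shows "b ^ k * real (card (D k \<rho>)) \<le> trunc_norm V E \<rho> b k"
proof -
  have "b ^ k * real (card (D k \<rho>)) = b ^ k * real (card (truncD k k \<rho>))"
    by (simp add: truncD_root)
  also have "\<dots> \<le> (\<Sum>r\<le>k. b ^ r * real (card (truncD k r \<rho>)))"
    using assms by (intro member_le_sum) auto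
  also have "\<dots> = desc_gf (verts k) (trunc_edges V E \<rho> k) \<rho> b \<rho>"
    by (rule trunc_desc_gf_eq[symmetric])
  also have "\<dots> \<le> trunc_norm V E \<rho> b k"
    unfolding trunc_norm_def desc_gf_norm_def
    by (intro member_le_L2_set finite_verts root_in_verts)
  finally show ?thesis .
qed

section \<open>Subperiodic trees\<close>

text \<open>
  The isomorphism maps the path from \<open>v\<close> down to a descendant to a path from \<open>w\<close>, which by
  uniqueness is the tail of a path from the root; hence the generation is preserved, and injectivity
  compares cardinalities.
\<close>

lemma card_desc_at_le_of_embedding:
  assumes V': "V' \<subseteq> desc_verts V E \<rho> w" and E': "E' \<subseteq> desc_edges V E \<rho> w"
    and iso: "rooted_isomorphic (desc_verts V E \<rho> v) (desc_edges V E \<rho> v) v V' E' w"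
  shows "card (D r v) \<le> card (D r w)"
proof -
  obtain f where f: "bij_betw f (desc_verts V E \<rho> v) V'" "f v = w"
    and edge: "\<And>x y. x \<in> desc_verts V E \<rho> v \<Longrightarrow> y \<in> desc_verts V E \<rho> v \<Longrightarrow>
      {x, y} \<in> desc_edges V E \<rho> v \<Longrightarrow> {f x, f y} \<in> E'"
    using iso unfolding rooted_isomorphic_def by blast
  have inj: "inj_on f (desc_verts V E \<rho> v)" and img: "f ` desc_verts V E \<rho> v = V'"
    using f(1) by (auto simp: bij_betw_def)
  have "f u \<in> D r w" if u: "u \<in> D r v" for u
  proof -
    obtain p q where pq: "graph_path V E \<rho> (p @ v # q) u" "length q = r"
      using u by (rule desc_atE)
    have path: "graph_path V E v (v # q) u" using pq(1) by (rule graph_path_suffix)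
    have sub: "set (v # q) \<subseteq> desc_verts V E \<rho> v"
    proof
      fix x
      assume x: "x \<in> set (v # q)"
      then obtain xs ys where xs: "v # q = xs @ x # ys" by (meson split_list)
      have "graph_path V E \<rho> ((p @ xs) @ x # ys) u" using pq(1) xs by simp
      then have "graph_path V E \<rho> ((p @ xs) @ [x]) x" by (rule graph_path_prefix)
      moreover have "v \<in> set ((p @ xs) @ [x])" using xs by (cases xs) auto
      moreover have "x \<in> V" using x path by (auto simp: graph_path_def graph_walk_def)
      ultimately show "x \<in> desc_verts V E \<rho> v"
        unfolding desc_verts_def descendant_def by blast
    qed
    have "successively (\<lambda>x y. {f x, f y} \<in> E) (v # q)"
    proof (rule successively_mono)
      show "successively (\<lambda>x y. {x, y} \<in> E) (v # q)"
        using path by (simp add: graph_path_def graph_walk_def)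
    next
      fix x y
      assume xy: "x \<in> set (v # q)" "y \<in> set (v # q)" "{x, y} \<in> E"
      then have "{x, y} \<in> desc_edges V E \<rho> v"
        using sub by (auto simp: desc_edges_def induced_edges_def)
      then show "{f x, f y} \<in> E"
        using edge xy sub E' by (auto simp: desc_edges_def induced_edges_def)
    qed
    then have succ: "successively (\<lambda>x y. {x, y} \<in> E) (map f (v # q))"
      by (simp only: successively_map)
    have imgV: "f ` desc_verts V E \<rho> v \<subseteq> V" using img V' by (auto simp: desc_verts_def)
    have "distinct (v # q)" using path by (simp add: graph_path_def)
    then have "distinct (map f (v # q))"
      using inj_on_subset[OF inj sub] by (simp only: distinct_map)
    moreover have "set (map f (v # q)) \<subseteq> V"
      using image_mono[OF sub, of f] imgV by (simp only: set_map)
    moreover have "last (map f (v # q)) = f u"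
      using path by (subst last_map) (auto simp: graph_path_def graph_walk_def)
    ultimately have fpath: "graph_path V E w (map f (v # q)) (f u)"
      using succ f(2) by (simp add: graph_path_def graph_walk_def)
    have "u \<in> set (v # q)"
      using path last_in_set[of "v # q"] unfolding graph_path_def graph_walk_def by metis
    then have "f u \<in> desc_verts V E \<rho> w" using sub img V' by blast
    then obtain p' where p': "graph_path V E \<rho> p' (f u)" "w \<in> set p'"
      by (auto simp: desc_verts_def descendant_def)
    obtain p1 q1 where p1: "p' = p1 @ w # q1" using p'(2) by (meson split_list)
    have "w # q1 = map f (v # q)"
      using path_unique[OF graph_path_suffix[OF p'(1)[unfolded p1]] fpath] .
    then have "length q1 = r" using pq(2) by (metis length_map length_Cons nat.inject)
    then show ?thesis using desc_atI p'(1) p1 by blast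
  qed
  then have "f ` D r v \<subseteq> D r w" by blast
  moreover have "D r v \<subseteq> desc_verts V E \<rho> v" by (auto simp: desc_at_def desc_verts_def)
  then have "inj_on f (D r v)" using inj inj_on_subset by blast
  ultimately show ?thesis using finite_desc_at card_inj_on_le[of f "D r v" "D r w"] by simp
qed

lemma subperiodic_card_le_level:
  assumes "subperiodic V E \<rho>"
  shows "\<exists>R. \<forall>r. \<forall>v\<in>V. \<exists>j\<le>R. card (D r v) \<le> card (D (j + r) \<rho>)"
proof -
  obtain R where R: "\<And>v. v \<in> V \<Longrightarrow> \<exists>w\<in>V. depth w \<le> R \<and>
      (\<exists>V' E'. V' \<subseteq> desc_verts V E \<rho> w \<and> E' \<subseteq> desc_edges V E \<rho> w \<and>
         rooted_tree V' E' w \<and>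
         rooted_isomorphic (desc_verts V E \<rho> v) (desc_edges V E \<rho> v) v V' E' w)"
    using assms unfolding subperiodic_def by blast
  have "\<exists>j\<le>R. card (D r v) \<le> card (D (j + r) \<rho>)" if "v \<in> V" for r v
  proof -
    obtain w where w: "w \<in> V" "depth w \<le> R" and le: "card (D r v) \<le> card (D r w)"
      using R[OF \<open>v \<in> V\<close>] card_desc_at_le_of_embedding by blast
    have "w \<in> D (depth w) \<rho>" using w(1) by (simp add: level_eq)
    then have "card (D r w) \<le> card (D (depth w + r) \<rho>)"
      by (rule card_mono[OF finite_desc_at desc_at_trans])
    then show ?thesis using w(2) le by (meson le_trans)
  qed
  then show ?thesis by blast
qed

end

section \<open>Growth rates and exponential bounds\<close>

text \<open>
  Constant factors do not matter for \<open>r\<close>-th roots. This and the next lemma translate between the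
  growth rates and exponential bounds.
\<close>

lemma limsup_root_le:
  fixes F :: "nat \<Rightarrow> ennreal" and C h :: real
  assumes "0 < C" "0 \<le> h"
    and le: "eventually (\<lambda>r. F r \<le> ennreal ((C * h ^ r) powr (1 / real r))) sequentially"
  shows "limsup F \<le> ennreal h"
proof -
  have "eventually (\<lambda>r. F r \<le> ennreal (C powr (1 / real r) * h)) sequentially"
    using le eventually_gt_at_top[of 0]
  proof eventually_elim
    case (elim r)
    have "(h ^ r) powr (1 / real r) = h"
    proof (cases "h = 0")
      case False
      then show ?thesis
        using assms(2) elim(2) by (simp add: powr_powr flip: powr_realpow)
    qed (use elim(2) in simp)
    then show ?case using elim(1) assms by (simp add: powr_mult)
  qed
  then have "limsup F \<le> limsup (\<lambda>r. ennreal (C powr (1 / real r) * h))"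
    by (rule Limsup_mono)
  also have "(\<lambda>r. C powr (1 / real r) * h) \<longlonglongrightarrow> C powr 0 * h"
    using assms(1) by (intro tendsto_intros lim_1_over_n) auto
  then have "(\<lambda>r. ennreal (C powr (1 / real r) * h)) \<longlonglongrightarrow> ennreal h"
    using assms(1) by (intro tendsto_ennrealI) simp
  then have "limsup (\<lambda>r. ennreal (C powr (1 / real r) * h)) = ennreal h"
    by (intro lim_imp_Limsup) auto
  finally show ?thesis .
qed

lemma le_power_of_limsup_root_less:
  fixes x :: "nat \<Rightarrow> 'b \<Rightarrow> real"
  assumes "limsup (\<lambda>r. SUP v\<in>A. ennreal (x r v powr (1 / real r))) < ennreal h"
    and nonneg: "\<And>r v. 0 \<le> x r v"
  shows "\<exists>K. \<forall>r\<ge>K. \<forall>v\<in>A. x r v \<le> h ^ r"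
proof -
  have "eventually (\<lambda>r. (SUP v\<in>A. ennreal (x r v powr (1 / real r))) < ennreal h) sequentially"
    using assms(1) by (rule Limsup_lessD)
  then have "eventually (\<lambda>r. \<forall>v\<in>A. x r v \<le> h ^ r) sequentially"
    using eventually_gt_at_top[of 0]
  proof eventually_elim
    case (elim r)
    show ?case
    proof
      fix v assume "v \<in> A"
      then have "ennreal (x r v powr (1 / real r)) < ennreal h"
        using elim(1) by (meson SUP_upper le_less_trans)
      then have lt: "x r v powr (1 / real r) < h" by (simp add: ennreal_less_iff)
      then have "0 \<le> h" using powr_ge_zero[of "x r v" "1 / real r"] by linarith
      show "x r v \<le> h ^ r"
      proof (cases "x r v = 0")
        case False
        then have "x r v = (x r v powr (1 / real r)) ^ r"
          using nonneg[of r v] elim(2) by (simp add: powr_powr flip: powr_realpow)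
        also have "\<dots> \<le> h ^ r" using lt by (intro power_mono) auto
        finally show ?thesis .
      qed (use \<open>0 \<le> h\<close> in simp)
    qed
  qed
  then show ?thesis by (simp add: eventually_sequentially)
qed

section \<open>Asymptotics of the truncated norms\<close>

context locally_finite_tree
begin

lemma maxgr_subcritical_bound:
  assumes "0 < b" and sub: "ennreal (b\<^sup>2) * maxgr V E \<rho> < 1"
  shows "\<exists>h K. 0 \<le> h \<and> b\<^sup>2 * h < 1 \<and> (\<forall>r\<ge>K. \<forall>v\<in>V. real (card (D r v)) \<le> h ^ r)"
proof -
  have "maxgr V E \<rho> \<noteq> top"
    using sub \<open>0 < b\<close> by (auto simp: ennreal_mult_top)
  then obtain g where g: "maxgr V E \<rho> = ennreal g" "0 \<le> g"
    by (cases "maxgr V E \<rho>") auto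
  have "b\<^sup>2 * g < 1" using sub g by (simp add: ennreal_less_one_iff flip: ennreal_mult')
  then have "g < 1 / b\<^sup>2" using \<open>0 < b\<close> by (simp add: field_simps)
  then obtain h where h: "g < h" "h < 1 / b\<^sup>2" using dense by blast
  have "limsup (\<lambda>r. SUP v\<in>V. ennreal (real (card (D r v)) powr (1 / real r))) < ennreal h"
    using g h(1) by (simp add: maxgr_def[symmetric] ennreal_less_iff)
  then have "\<exists>K. \<forall>r\<ge>K. \<forall>v\<in>V. real (card (D r v)) \<le> h ^ r"
    by (rule le_power_of_limsup_root_less) simp
  moreover have "b\<^sup>2 * h < 1" using h(2) \<open>0 < b\<close> by (simp add: field_simps)
  moreover have "0 \<le> h" using g(2) h(1) by simp
  ultimately show ?thesis by blast
qed

text \<open>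
  The numbers \<open>sup\<^sub>v b\<^sup>r |D\<^sub>r(v)|\<^sup>1\<^sup>/\<^sup>2\<close> are eventually dominated by a geometric series of ratio
  \<open>b \<surd>h < 1\<close>, where \<open>h\<close> lies between \<open>maxgr\<close> and \<open>b\<^sup>-\<^sup>2\<close>. If \<open>b = 0\<close>, then \<open>maxgr\<close> and \<open>sup\<^sub>v |D\<^sub>r(v)|\<close>
  can be infinite, but only the term \<open>r = 0\<close> survives.
\<close>

lemma summable_weights:
  assumes "0 \<le> b" and sub: "ennreal (b\<^sup>2) * maxgr V E \<rho> < 1"
  shows "\<exists>c. summable c \<and> (\<forall>r. \<forall>v\<in>V. b ^ r * sqrt (real (card (D r v))) \<le> c r)"
proof (cases "b = 0")
  case True
  define c :: "nat \<Rightarrow> real" where "c = (\<lambda>r. if r = 0 then 1 else 0)"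
  have "summable c" unfolding c_def using sums_single[of 0 "\<lambda>_. 1"] sums_summable by blast
  moreover have "b ^ r * sqrt (real (card (D r v))) \<le> c r" for r v
    using True card_mono[OF _ desc_at_0_subset[of \<rho> v]] by (auto simp: c_def power_0_left)
  ultimately show ?thesis by blast
next
  case False
  then have "0 < b" using assms(1) by simp
  obtain K h where h: "0 \<le> h" "b\<^sup>2 * h < 1"
    and K: "\<And>r v. K \<le> r \<Longrightarrow> v \<in> V \<Longrightarrow> real (card (D r v)) \<le> h ^ r"
    using maxgr_subcritical_bound[OF \<open>0 < b\<close> sub] by blast
  have "\<exists>B. \<forall>v\<in>V. card (D r v) \<le> B" if "r \<le> K" for r
  proof -
    have "card (D K v) \<le> nat \<lfloor>h ^ K\<rfloor>" if "v \<in> V" for v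
      using K[OF le_refl that] by (simp add: le_nat_floor)
    then show ?thesis using \<open>r \<le> K\<close> by (rule card_desc_at_bounded_downward)
  qed
  then obtain B where B: "\<And>r v. r \<le> K \<Longrightarrow> v \<in> V \<Longrightarrow> card (D r v) \<le> B r" by metis
  \<comment> \<open>below \<open>K\<close> only finiteness of the suprema is available\<close>
  define c where "c = (\<lambda>r. if r < K then b ^ r * sqrt (real (B r)) else (b * sqrt h) ^ r)"
  have "(b * sqrt h)\<^sup>2 < 1\<^sup>2" using h by (simp add: power_mult_distrib)
  then have "b * sqrt h < 1" by (rule power2_less_imp_less) simp
  then have "summable (\<lambda>r. (b * sqrt h) ^ r)"
    using \<open>0 < b\<close> h(1) by (intro summable_geometric) simp
  moreover have "eventually (\<lambda>r. c r = (b * sqrt h) ^ r) sequentially"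
    using eventually_ge_at_top[of K] by eventually_elim (simp add: c_def)
  ultimately have "summable c" using summable_cong by blast
  moreover have "b ^ r * sqrt (real (card (D r v))) \<le> c r" if v: "v \<in> V" for r v
  proof (cases "r < K")
    case True
    then show ?thesis
      using B[of r v] v \<open>0 < b\<close> by (simp add: c_def)
  next
    case False
    then have "sqrt (real (card (D r v))) \<le> sqrt (h ^ r)"
      using K[of r v] v by simp
    then show ?thesis
      using False \<open>0 < b\<close> by (simp add: c_def power_mult_distrib real_sqrt_power)
  qed
  ultimately show ?thesis by blast
qed

text \<open>
  Keeping the weight \<open>b\<^sup>r\<close> in the assumed bound lets it hold for \<open>b = 0\<close> and \<open>r > 0\<close> even when
  \<open>|D\<^sub>r(v)|\<close> is unbounded in \<open>v\<close>.
\<close>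

lemma weighted_truncD_L2_le:
  assumes "0 \<le> b" and c: "\<And>v. v \<in> V \<Longrightarrow> b ^ r * sqrt (real (card (D r v))) \<le> c"
  shows "b ^ r * L2_set (\<lambda>v. real (card (truncD k r v))) (verts k) \<le> c * sqrt (real (card (verts k)))"
proof -
  have "0 \<le> b ^ r * sqrt (real (card (D r \<rho>)))" using \<open>0 \<le> b\<close> by simp
  then have "0 \<le> c" using c[OF root_in] by linarith
  show ?thesis
  proof (cases "b ^ r = 0")
    case True
    show ?thesis using \<open>0 \<le> c\<close> by (simp add: True)
  next
    case False
    then have pos: "0 < b ^ r" using zero_le_power[OF \<open>0 \<le> b\<close>, of r] by linarith
    have "real (card (D r v)) \<le> (c / b ^ r)\<^sup>2" if "v \<in> V" for v
    proof -
      have "sqrt (real (card (D r v))) \<le> c / b ^ r"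
        using c[OF that] pos by (simp add: pos_le_divide_eq mult.commute)
      then show ?thesis by (rule sqrt_le_D)
    qed
    then have "L2_set (\<lambda>v. real (card (truncD k r v))) (verts k)
        \<le> sqrt ((c / b ^ r)\<^sup>2) * sqrt (real (card (verts k)))"
      using zero_le_power2 by (rule truncD_L2_le_sqrt)
    also have "\<dots> = c * sqrt (real (card (verts k))) / b ^ r"
      using pos \<open>0 \<le> c\<close> by simp
    finally show ?thesis using pos by (simp add: pos_le_divide_eq mult.commute)
  qed
qed

lemma trunc_norm_bigo:
  assumes "0 \<le> b" and "ennreal (b\<^sup>2) * maxgr V E \<rho> < 1"
  shows "trunc_norm V E \<rho> b \<in> O(\<lambda>k. sqrt (real (card (verts k))))"
proof -
  obtain c where c: "summable c" "\<And>r v. v \<in> V \<Longrightarrow> b ^ r * sqrt (real (card (D r v))) \<le> c r"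
    using summable_weights[OF assms] by blast
  have nonneg: "0 \<le> c r" for r
  proof -
    have "0 \<le> b ^ r * sqrt (real (card (D r \<rho>)))" using \<open>0 \<le> b\<close> by simp
    then show ?thesis using c(2)[OF root_in, of r] by linarith
  qed
  have "trunc_norm V E \<rho> b k \<le> suminf c * sqrt (real (card (verts k)))" for k
  proof -
    have "trunc_norm V E \<rho> b k \<le> (\<Sum>r\<le>k. c r * sqrt (real (card (verts k))))"
      using trunc_norm_le[OF \<open>0 \<le> b\<close>, of k]
        sum_mono[OF weighted_truncD_L2_le[OF \<open>0 \<le> b\<close> c(2)], of "{..k}"]
      by (meson order_trans)
    also have "\<dots> = (\<Sum>r\<le>k. c r) * sqrt (real (card (verts k)))"
      by (simp add: sum_distrib_right)
    also have "\<dots> \<le> suminf c * sqrt (real (card (verts k)))"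
      using nonneg c(1) by (intro mult_right_mono sum_le_suminf) auto
    finally show ?thesis .
  qed
  then show ?thesis
    by (intro bigoI[of _ "suminf c"]) (simp add: trunc_norm_nonneg)
qed

text \<open>
  Divided by \<open>|V\<^sub>k|\<close>, the \<open>r\<close>-th term of the expansion is at most \<open>b\<^sup>r\<close>, uniformly in \<open>k\<close>, and for
  fixed \<open>r\<close> it is \<open>O(|V\<^sub>k|\<^sup>-\<^sup>1\<^sup>/\<^sup>2)\<close>. Since \<open>b < 1\<close>, Tannery's theorem allows passing to the limit
  term by term.
\<close>

lemma trunc_norm_smallo:
  assumes "infinite V" "0 \<le> b" "b < 1"
    and B: "\<And>r v. v \<in> V \<Longrightarrow> card (D r v) \<le> B r"
  shows "trunc_norm V E \<rho> b \<in> o(\<lambda>k. real (card (verts k)))"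
proof -
  let ?S = "\<lambda>k. real (card (verts k))"
  \<comment> \<open>the terms of the normalised expansion, extended by 0 to series as Tannery's theorem needs\<close>
  define a where "a = (\<lambda>r k. if r \<le> k
    then b ^ r * L2_set (\<lambda>v. real (card (truncD k r v))) (verts k) / ?S k else 0)"
  have S: "0 < ?S k" for k
    using root_in_verts finite_verts by (auto simp: card_gt_0_iff)
  have S_top: "filterlim ?S at_top sequentially" using assms(1) by (rule filterlim_card_verts)
  have a_nonneg: "0 \<le> a r k" for r k using \<open>0 \<le> b\<close> by (simp add: a_def)
  have a_le_power: "a r k \<le> b ^ r" for r k
    using \<open>0 \<le> b\<close> S[of k] truncD_L2_le_card[of k r]
    by (auto simp: a_def field_simps intro: mult_left_mono)
  have a_le_sqrt: "a r k \<le> b ^ r * sqrt (real (B r)) / sqrt (?S k)" for r k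
  proof -
    have "b ^ r * L2_set (\<lambda>v. real (card (truncD k r v))) (verts k)
        \<le> b ^ r * sqrt (real (B r)) * sqrt (?S k)"
      using B \<open>0 \<le> b\<close> by (intro weighted_truncD_L2_le mult_left_mono) auto
    then have "b ^ r * L2_set (\<lambda>v. real (card (truncD k r v))) (verts k) / ?S k
        \<le> b ^ r * sqrt (real (B r)) * sqrt (?S k) / ?S k"
      by (intro divide_right_mono) auto
    also have "\<dots> = b ^ r * sqrt (real (B r)) / sqrt (?S k)"
      using S[of k] by (simp add: field_simps)
    finally show ?thesis using \<open>0 \<le> b\<close> by (simp add: a_def)
  qed
  have lim: "(\<lambda>k. a r k) \<longlonglongrightarrow> 0" for r
  proof (rule tendsto_sandwich[OF _ _ tendsto_const])
    show "(\<lambda>k. b ^ r * sqrt (real (B r)) / sqrt (?S k)) \<longlonglongrightarrow> 0"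
      by (intro real_tendsto_divide_at_top[OF tendsto_const]
          filterlim_compose[OF sqrt_at_top S_top])
  qed (use a_nonneg a_le_sqrt in auto)
  have bound: "\<forall>\<^sub>F (r, k) in sequentially \<times>\<^sub>F sequentially. norm (a r k) \<le> b ^ r"
    using a_nonneg a_le_power by (intro always_eventually) auto
  have "summable (\<lambda>r. b ^ r)" using \<open>0 \<le> b\<close> \<open>b < 1\<close> by (intro summable_geometric) simp
  then have "(\<lambda>k. \<Sum>r. a r k) \<longlonglongrightarrow> (\<Sum>r. 0)"
    using tannerys_theorem[OF lim bound] by simp
  moreover have "(\<Sum>r. a r k) = (\<Sum>r\<le>k. a r k)" for k
    by (rule suminf_finite) (auto simp: a_def)
  ultimately have sum0: "(\<lambda>k. \<Sum>r\<le>k. a r k) \<longlonglongrightarrow> 0" by simp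
  have "(\<lambda>k. trunc_norm V E \<rho> b k / ?S k) \<longlonglongrightarrow> 0"
  proof (rule tendsto_sandwich[OF _ _ tendsto_const sum0])
    have "trunc_norm V E \<rho> b k / ?S k \<le> (\<Sum>r\<le>k. a r k)" for k
      using divide_right_mono[OF trunc_norm_le[OF \<open>0 \<le> b\<close>, of k], of "?S k"]
      by (simp add: a_def sum_divide_distrib)
    then show "\<forall>\<^sub>F k in sequentially. trunc_norm V E \<rho> b k / ?S k \<le> (\<Sum>r\<le>k. a r k)" by simp
  qed (simp add: trunc_norm_nonneg)
  then show ?thesis using S by (intro smalloI_tendsto) (auto simp: less_imp_neq[symmetric])
qed

text \<open>
  Write \<open>s k = \<surd>|V\<^sub>k|\<close>. If \<open>\<Delta>\<^sub>k \<le> C s k\<close>, then the last level has at most \<open>C b\<^sup>-\<^sup>k s k\<close> vertices, so that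
  \<open>(s k)\<^sup>2 - (s (k - 1))\<^sup>2 \<le> C b\<^sup>-\<^sup>k s k\<close>. Dividing by \<open>s k\<close> gives \<open>s k - s (k - 1) \<le> C b\<^sup>-\<^sup>k\<close>, and summing
  this geometric progression gives \<open>|V\<^sub>k| = O(b\<^sup>-\<^sup>2\<^sup>k)\<close>.
\<close>

lemma upper_gr_le_of_bigo:
  assumes "0 < b" "b < 1"
    and O: "trunc_norm V E \<rho> b \<in> O(\<lambda>k. sqrt (real (card (verts k))))"
  shows "upper_gr V E \<rho> \<le> ennreal (1 / b\<^sup>2)"
proof -
  define s where "s = (\<lambda>k. sqrt (real (card (verts k))))"
  have s_pos: "0 < s k" for k
    using root_in_verts finite_verts by (auto simp: s_def card_gt_0_iff)
  have s_sq: "s k * s k = real (card (verts k))" for k by (simp add: s_def)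
  obtain C where C: "0 < C"
    "eventually (\<lambda>k. norm (trunc_norm V E \<rho> b k) \<le> C * norm (s k)) sequentially"
    using landau_o.bigE[OF O] unfolding s_def by blast
  then obtain K where K: "\<And>k. K \<le> k \<Longrightarrow> trunc_norm V E \<rho> b k \<le> C * s k"
    using s_pos by (auto simp: eventually_sequentially less_imp_le trunc_norm_nonneg)
  have growth: "s (Suc k) \<le> s k + C / b ^ Suc k" if "K \<le> k" for k
  proof -
    have mono: "s k \<le> s (Suc k)" by (simp add: s_def card_verts_Suc)
    have "(s (Suc k) - s k) * s (Suc k) \<le> (s (Suc k) - s k) * (s (Suc k) + s k)"
      using mono s_pos[of k] by (intro mult_left_mono) auto
    also have "\<dots> = real (card (D (Suc k) \<rho>))"
      using s_sq[of k] s_sq[of "Suc k"] by (simp add: card_verts_Suc algebra_simps)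
    also have "\<dots> \<le> C / b ^ Suc k * s (Suc k)"
    proof -
      have "b ^ Suc k * real (card (D (Suc k) \<rho>)) \<le> C * s (Suc k)"
        using trunc_norm_ge_level[of b "Suc k"] K[of "Suc k"] that \<open>0 < b\<close> by linarith
      then show ?thesis using \<open>0 < b\<close> by (simp add: field_simps)
    qed
    finally have "s (Suc k) - s k \<le> C / b ^ Suc k"
      using s_pos[of "Suc k"] by (rule mult_right_le_imp_le)
    then show ?thesis by linarith
  qed
  \<comment> \<open>\<open>A (1 - b) \<ge> C\<close> is what lets the bound \<open>A / b\<^sup>k\<close> absorb the increment \<open>C / b\<^sup>k\<^sup>+\<^sup>1\<close>\<close>
  define A where "A = max (s K) (C / (1 - b))"
  have A: "0 < A" "C \<le> A * (1 - b)"
  proof -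
    show "0 < A" using s_pos[of K] by (simp add: A_def)
    have "C / (1 - b) \<le> A" by (simp add: A_def)
    then show "C \<le> A * (1 - b)" using \<open>b < 1\<close> by (simp add: pos_divide_le_eq)
  qed
  have s_le: "s k \<le> A / b ^ k" if "K \<le> k" for k
    using that
  proof (induction k rule: dec_induct)
    case base
    have "A * b ^ K \<le> A * 1"
      using A(1) assms(1,2) by (intro mult_left_mono power_le_one) auto
    then have "A \<le> A / b ^ K" using \<open>0 < b\<close> by (simp add: field_simps)
    then show ?case by (simp add: A_def)
  next
    case (step k)
    have "s (Suc k) \<le> A / b ^ k + C / b ^ Suc k" using growth[OF step(1)] step.IH by linarith
    also have "\<dots> = (A * b + C) / b ^ Suc k" using \<open>0 < b\<close> by (simp add: field_simps)
    also have "\<dots> \<le> A / b ^ Suc k"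
      using A(2) \<open>0 < b\<close> by (intro divide_right_mono) (auto simp: algebra_simps)
    finally show ?case .
  qed
  have level_le: "real (card (D k \<rho>)) \<le> A\<^sup>2 * (1 / b\<^sup>2) ^ k" if "K \<le> k" for k
  proof -
    have "real (card (D k \<rho>)) \<le> (s k)\<^sup>2"
      using card_level_le[of k] s_sq[of k] by (simp add: power2_eq_square)
    also have "\<dots> \<le> (A / b ^ k)\<^sup>2" using s_le[OF that] s_pos[of k] by (intro power_mono) auto
    also have "\<dots> = A\<^sup>2 * (1 / b\<^sup>2) ^ k"
      by (simp add: power_divide mult.commute flip: power_mult)
    finally show ?thesis .
  qed
  show ?thesis
    unfolding upper_gr_def
  proof (rule limsup_root_le)
    show "\<forall>\<^sub>F r in sequentially. ennreal (real (card (D r \<rho>)) powr (1 / real r))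
        \<le> ennreal ((A\<^sup>2 * (1 / b\<^sup>2) ^ r) powr (1 / real r))"
      using eventually_ge_at_top[of K]
      by eventually_elim (intro ennreal_leI powr_mono2 level_le; simp)
  qed (use A in auto)
qed

lemma upper_gr_le_maxgr: "upper_gr V E \<rho> \<le> maxgr V E \<rho>"
  unfolding upper_gr_def maxgr_def
  by (intro Limsup_mono always_eventually allI SUP_upper root_in)

text \<open>
  For subperiodic trees every \<open>|D\<^sub>r(v)|\<close> is bounded by the size of one of the levels \<open>r, \<dots>, r + R\<close>,
  so an exponential bound on the levels carries over to all vertices with a factor that is
  independent of \<open>r\<close>.
\<close>

lemma maxgr_eq_upper_gr:
  assumes "subperiodic V E \<rho>"
  shows "maxgr V E \<rho> = upper_gr V E \<rho>"
proof (rule antisym[OF dense_ge upper_gr_le_maxgr])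
  fix z assume z: "upper_gr V E \<rho> < z"
  show "maxgr V E \<rho> \<le> z"
  proof (cases z)
    case (real h)
    have "limsup (\<lambda>r. SUP v\<in>{\<rho>}. ennreal (real (card (D r v)) powr (1 / real r))) < ennreal h"
      using z real by (simp add: upper_gr_def)
    then have "\<exists>K. \<forall>r\<ge>K. \<forall>v\<in>{\<rho>}. real (card (D r v)) \<le> h ^ r"
      by (rule le_power_of_limsup_root_less) simp
    then obtain K where K: "\<And>r. K \<le> r \<Longrightarrow> real (card (D r \<rho>)) \<le> h ^ r" by blast
    obtain R where R: "\<And>r v. v \<in> V \<Longrightarrow> \<exists>j\<le>R. card (D r v) \<le> card (D (j + r) \<rho>)"
      using subperiodic_card_le_level[OF assms] by blast
    \<comment> \<open>the maximum covers all shifts \<open>j \<le> R\<close>, also when \<open>h < 1\<close>\<close>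
    define C where "C = max 1 h ^ R"
    have le: "real (card (D r v)) \<le> C * h ^ r" if "K \<le> r" "v \<in> V" for r v
    proof -
      obtain j where j: "j \<le> R" "card (D r v) \<le> card (D (j + r) \<rho>)" using R[OF \<open>v \<in> V\<close>] by blast
      have "real (card (D r v)) \<le> h ^ (j + r)" using j(2) K[of "j + r"] that(1) by simp
      also have "\<dots> = h ^ j * h ^ r" by (rule power_add)
      also have "\<dots> \<le> C * h ^ r"
      proof (intro mult_right_mono)
        have "h ^ j \<le> max 1 h ^ j" using real by (intro power_mono) auto
        also have "\<dots> \<le> C" unfolding C_def using j(1) by (intro power_increasing) auto
        finally show "h ^ j \<le> C" .
      qed (use real in simp)
      finally show ?thesis .
    qed
    have "maxgr V E \<rho> \<le> ennreal h"
      unfolding maxgr_def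
    proof (rule limsup_root_le)
      show "\<forall>\<^sub>F r in sequentially. (SUP v\<in>V. ennreal (real (card (D r v)) powr (1 / real r)))
          \<le> ennreal ((C * h ^ r) powr (1 / real r))"
        using eventually_ge_at_top[of K]
        by eventually_elim (intro SUP_least ennreal_leI powr_mono2 le; simp)
    qed (use real in \<open>auto simp: C_def\<close>)
    then show ?thesis using real by simp
  qed simp
qed

end

theorem theorem3:
  fixes V :: "'a set" and E :: "'a set set" and \<rho> :: 'a and b :: real
  assumes "rooted_tree V E \<rho>" and "infinite V" and "locally_finite_graph V E"
    and "0 \<le> b" and "b < 1"
  shows
    "(bounded_degree V E \<longrightarrow>
        trunc_norm V E \<rho> b \<in> o(\<lambda>k. real (card (trunc_verts V E \<rho> k)))) \<and>
     (ennreal (b\<^sup>2) * maxgr V E \<rho> < 1 \<longrightarrow>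
        trunc_norm V E \<rho> b \<in> O(\<lambda>k. sqrt (real (card (trunc_verts V E \<rho> k))))) \<and>
     (ennreal (b\<^sup>2) * upper_gr V E \<rho> > 1 \<longrightarrow>
        trunc_norm V E \<rho> b \<notin> O(\<lambda>k. sqrt (real (card (trunc_verts V E \<rho> k))))) \<and>
     (subperiodic V E \<rho> \<longrightarrow>
        maxgr V E \<rho> = upper_gr V E \<rho> \<and>
        (ennreal (b\<^sup>2) * upper_gr V E \<rho> < 1 \<longrightarrow>
           trunc_norm V E \<rho> b \<in> O(\<lambda>k. sqrt (real (card (trunc_verts V E \<rho> k))))) \<and>
        (ennreal (b\<^sup>2) * upper_gr V E \<rho> > 1 \<longrightarrow>
           trunc_norm V E \<rho> b \<notin> O(\<lambda>k. sqrt (real (card (trunc_verts V E \<rho> k))))))"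
proof -
  interpret locally_finite_tree V E \<rho>
    using assms(1,3) by unfold_locales (auto simp: rooted_tree_def graph_tree_def)
  have bounded: "trunc_norm V E \<rho> b \<in> o(\<lambda>k. real (card (verts k)))" if bd: "bounded_degree V E"
  proof -
    obtain M where "\<And>v. v \<in> V \<Longrightarrow> card (neighbours E v) \<le> M"
      using bd unfolding bounded_degree_def by blast
    then have "card (D r v) \<le> M ^ r" for r v by (rule card_desc_at_le_power)
    then show ?thesis by (rule trunc_norm_smallo[OF assms(2,4,5)])
  qed
  have super: "trunc_norm V E \<rho> b \<notin> O(\<lambda>k. sqrt (real (card (verts k))))"
    if gt: "ennreal (b\<^sup>2) * upper_gr V E \<rho> > 1"
  proof
    assume O: "trunc_norm V E \<rho> b \<in> O(\<lambda>k. sqrt (real (card (verts k))))"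
    have "b \<noteq> 0" using gt by auto
    then have "0 < b" using assms(4) by simp
    then have "ennreal (b\<^sup>2) * upper_gr V E \<rho> \<le> ennreal (b\<^sup>2) * ennreal (1 / b\<^sup>2)"
      using upper_gr_le_of_bigo[OF _ assms(5) O] by (intro mult_left_mono) auto
    also have "\<dots> = 1" using \<open>0 < b\<close> by (simp flip: ennreal_mult')
    finally show False using gt by simp
  qed
  show ?thesis
    using bounded super trunc_norm_bigo[OF assms(4)] maxgr_eq_upper_gr by metis
qed

end
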